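(* Let $t=\sum_{i=0}^{k} t_i 2^i \ge 0$ for some $k\in\mathbb{Z}_{\ge 0}$, where $t_i\in\{0,1\}$ for $0\le i\le k$ and $t_i=0$ for $i>k$. Then $$num_a(t)=\sum_{i=0}^{k} t_{k-i}\,4^{\sum_{j=0}^{i} t_{k-j+1}}\left(2^{k-i+1}-t+\sum_{j=0}^{i} t_{k-j+1}2^{k-j+1}\right)^2,$$ and for every $k\in\mathbb{Z}_{\ge 0}$, $$cum_a(2^k)=\frac{1}{18}\left(2\cdot 8^k+8\cdot 5^k+9\cdot 4^k-2^k\right).$$
   Context: A two-dimensional elementary cellular automaton is a map $T:\{0,1\}^{\mathbb{Z}^2}\to\{0,1\}^{\mathbb{Z}^2}$ such that $(Tx)_{i,j}$ is given by a fixed local rule $f:\{0,1\}^5\to\{0,1\}$ applied to the center $C=x_{i,j}$ and its four von Neumann neighbors $U=x_{i,j+1}$, $D=x_{i,j-1}$, $L=x_{i-1,j}$, $R=x_{i+1,j}$. It is symmetrical if $f$ is invariant under left-right and top-bottom reflections and under rotations by multiples of $90^\circ$ of the four neighbors. Call two neighbors opposite if they are $\{U,D\}$ or $\{L,R\}$, and adjacent otherwise. $T_a$ denotes any symmetrical two-dimensional elementary cellular automaton whose local rule satisfies the following. If $C=0$: output $0$ if no neighbor is $1$; output $1$ if exactly one neighbor is $1$; output $0$ if exactly two neighbors are $1$ and they are adjacent; output $1$ if exactly two neighbors are $1$ and they are opposite; output $1$ if all four neighbors are $1$; if exactly three neighbors are $1$ the output is arbitrary. If $C=1$: output $0$ if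 no neighbor is $1$; all other outputs are arbitrary. (The arbitrary values, chosen compatibly with the symmetry, do not affect the orbit considered.) The single site seed $x_o\in\{0,1\}^{\mathbb{Z}^2}$ has $(x_o)_{0,0}=1$ and all other entries $0$. Define $num_a(0)=cum_a(0)=0$ and, for $t\ge1$, $num_a(t)=\sum_{(i,j)\in\mathbb{Z}^2}(T_a^{t-1}x_o)_{i,j}$ and $cum_a(t)=\sum_{n=1}^{t}num_a(n)$. *)

theory Defs
  imports Complex_Main "HOL-Library.Groups_Big_Fun"
begin

text \<open>The alphabet \<open>{0,1}\<close> is \<^typ>\<open>bool\<close>. A local rule takes its arguments in the order
  center, up, down, left, right.\<close>

type_synonym config = "int \<times> int \<Rightarrow> bool"
type_synonym local_rule = "bool \<Rightarrow> bool \<Rightarrow> bool \<Rightarrow> bool \<Rightarrow> bool \<Rightarrow> bool"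

definition elementary_ca :: "local_rule \<Rightarrow> config \<Rightarrow> config" where
  "elementary_ca f x =
     (\<lambda>(i, j). f (x (i, j)) (x (i, j + 1)) (x (i, j - 1)) (x (i - 1, j)) (x (i + 1, j)))"

text \<open>The conjuncts are the left-right reflection, the top-bottom reflection and the
  quarter turn; the latter generates all rotations.\<close>

definition symmetrical_rule :: "local_rule \<Rightarrow> bool" where
  "symmetrical_rule f \<longleftrightarrow>
     (\<forall>c u d l r. f c u d r l = f c u d l r) \<and>
     (\<forall>c u d l r. f c d u l r = f c u d l r) \<and>
     (\<forall>c u d l r. f c r l u d = f c u d l r)"

definition num_neighbors :: "bool \<Rightarrow> bool \<Rightarrow> bool \<Rightarrow> bool \<Rightarrow> nat" where
  "num_neighbors u d l r = of_bool u + of_bool d + of_bool l + of_bool r"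

definition some_opposite :: "bool \<Rightarrow> bool \<Rightarrow> bool \<Rightarrow> bool \<Rightarrow> bool" where
  "some_opposite u d l r \<longleftrightarrow> (u \<and> d) \<or> (l \<and> r)"

definition T_a_rule :: "local_rule \<Rightarrow> bool" where
  "T_a_rule f \<longleftrightarrow> symmetrical_rule f \<and>
     (\<forall>u d l r.
        (num_neighbors u d l r = 0 \<longrightarrow> \<not> f False u d l r) \<and>
        (num_neighbors u d l r = 1 \<longrightarrow> f False u d l r) \<and>
        (num_neighbors u d l r = 2 \<and> \<not> some_opposite u d l r \<longrightarrow> \<not> f False u d l r) \<and>
        (num_neighbors u d l r = 2 \<and> some_opposite u d l r \<longrightarrow> f False u d l r) \<and>
        (num_neighbors u d l r = 4 \<longrightarrow> f False u d l r) \<and>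
        (num_neighbors u d l r = 0 \<longrightarrow> \<not> f True u d l r))"

definition single_site_seed :: config where
  "single_site_seed = (\<lambda>p. p = (0, 0))"

text \<open>\<^const>\<open>Sum_any\<close> is the sum over the whole lattice of a finitely supported family; that
  the support is finite for every rule considered here is proved below.\<close>

definition num_sites :: "(config \<Rightarrow> config) \<Rightarrow> nat \<Rightarrow> nat" where
  "num_sites T t =
     (if t = 0 then 0 else Sum_any (\<lambda>p. of_bool ((T ^^ (t - 1)) single_site_seed p)))"

definition cum_sites :: "(config \<Rightarrow> config) \<Rightarrow> nat \<Rightarrow> nat" where
  "cum_sites T t = (\<Sum>n = 1..t. num_sites T n)"

lemma finite_support_elementary_ca:
  assumes f: "\<not> f False False False False False" and fin: "finite {p. x p}"
  shows "finite {p. elementary_ca f x p}"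
proof (rule finite_subset)
  let ?S = "{p. x p}"
  let ?N = "?S \<union> (\<lambda>(i, j). (i, j - 1)) ` ?S \<union> (\<lambda>(i, j). (i, j + 1)) ` ?S
      \<union> (\<lambda>(i, j). (i + 1, j)) ` ?S \<union> (\<lambda>(i, j). (i - 1, j)) ` ?S"
  show "finite ?N" using fin by simp
  show "{p. elementary_ca f x p} \<subseteq> ?N"
  proof clarify
    fix i j
    assume *: "elementary_ca f x (i, j)" and nin: "(i, j) \<notin> (\<lambda>(i, j). (i - 1, j)) ` ?S"
      "(i, j) \<notin> (\<lambda>(i, j). (i + 1, j)) ` ?S" "(i, j) \<notin> (\<lambda>(i, j). (i, j + 1)) ` ?S"
      "(i, j) \<notin> (\<lambda>(i, j). (i, j - 1)) ` ?S"
    have "\<not> x (i + 1, j)" "\<not> x (i - 1, j)" "\<not> x (i, j - 1)" "\<not> x (i, j + 1)"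
      using nin by (force simp: image_iff)+
    then show "x (i, j)"
      using * f by (cases "x (i, j)") (auto simp: elementary_ca_def)
  qed
qed

lemma finite_support_orbit:
  assumes "T_a_rule f"
  shows "finite {p. (elementary_ca f ^^ n) single_site_seed p}"
proof (induction n)
  case 0
  show ?case by (simp add: single_site_seed_def)
next
  case (Suc n)
  have "num_neighbors False False False False = 0"
    by (simp add: num_neighbors_def)
  with assms have "\<not> f False False False False False"
    unfolding T_a_rule_def by blast
  then show ?case
    using finite_support_elementary_ca[where x = "(elementary_ca f ^^ n) single_site_seed"] Suc
    by simp
qed

lemma T_a_rule_exists: "\<exists>f. T_a_rule f"
proof
  show "T_a_rule (\<lambda>c u d l r. let n = num_neighbors u d l r in
      n = 1 \<or> n = 2 \<and> some_opposite u d l r \<or> n = 4)"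
    by (auto simp: T_a_rule_def symmetrical_rule_def num_neighbors_def some_opposite_def Let_def)
qed

end

theory Submission
  imports Defs "HOL-Library.FuncSet"
begin

text \<open>A site can be 1 at time \<open>n\<close> only if \<open>i + j + n\<close> is even, so a nonzero site never has a
  nonzero neighbor and only the outputs for center 0, together with \<open>f(1; 0, 0, 0, 0) = 0\<close>, matter.
  In the rotated coordinates \<open>i = a + b - n\<close>, \<open>j = a - b\<close> the orbit evolves on sites \<open>(a, b)\<close>
  with \<open>0 \<le> a, b \<le> n\<close>, each new site looking at the four corners of a unit square. After
  \<open>2^k - 1\<close> steps this square is full. A further \<open>s \<le> 2^k\<close> steps leave a full centered square of
  side \<open>2^k - s\<close> and four copies of the configuration after \<open>s - 1\<close> steps in the corners; the copies
  meet the center only diagonally, where "exactly one" and "exactly two opposite" neighbors both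
  give 1. Hence \<open>num(2^k + s) = (2^k - s)^2 + 4 num(s)\<close>, which yields both formulas.\<close>

section \<open>The local rule in rotated coordinates\<close>

type_synonym plane = "int \<Rightarrow> int \<Rightarrow> bool"

text \<open>The pairs up/down and left/right become the two diagonals of a unit square. The center
  is fixed to \<open>False\<close> because it has the wrong parity.\<close>

definition evolve :: "local_rule \<Rightarrow> plane \<Rightarrow> plane" where
  "evolve f y a b = f False (y a (b - 1)) (y (a - 1) b) (y (a - 1) (b - 1)) (y a b)"

primrec rotated_orbit :: "local_rule \<Rightarrow> nat \<Rightarrow> plane" where
  "rotated_orbit f 0 = (\<lambda>a b. a = 0 \<and> b = 0)"
| "rotated_orbit f (Suc n) = evolve f (rotated_orbit f n)"

text \<open>Intended for \<open>y\<close> supported in a box of side \<open>s\<close>, which is one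
  more than the number of steps that produced \<open>y\<close>.\<close>

definition square_with_copies :: "int \<Rightarrow> int \<Rightarrow> plane \<Rightarrow> plane" where
  "square_with_copies K s y a b \<longleftrightarrow> (s \<le> a \<and> a < K \<and> s \<le> b \<and> b < K)
     \<or> y a b \<or> y (a - K) b \<or> y a (b - K) \<or> y (a - K) (b - K)"

lemma T_a_rule_simps:
  assumes "T_a_rule f"
  shows "\<not> f c False False False False"
    "f False True False False False" "f False False True False False"
    "f False False False True False" "f False False False False True"
    "f False True True False False" "f False False False True True"
    "\<not> f False True False True False" "\<not> f False True False False True"
    "\<not> f False False True True False" "\<not> f False False True False True"
    "f False True True True True"
proof -
  have *: "(num_neighbors u d l r = 0 \<longrightarrow> \<not> f False u d l r) \<and>
        (num_neighbors u d l r = 1 \<longrightarrow> f False u d l r) \<and>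
        (num_neighbors u d l r = 2 \<and> \<not> some_opposite u d l r \<longrightarrow> \<not> f False u d l r) \<and>
        (num_neighbors u d l r = 2 \<and> some_opposite u d l r \<longrightarrow> f False u d l r) \<and>
        (num_neighbors u d l r = 4 \<longrightarrow> f False u d l r) \<and>
        (num_neighbors u d l r = 0 \<longrightarrow> \<not> f True u d l r)" for u d l r
    using assms unfolding T_a_rule_def by blast
  note ** = *[unfolded num_neighbors_def some_opposite_def]
  show "\<not> f c False False False False"
    using **[of False False False False] by (cases c) simp_all
  show "f False True False False False" "f False False True False False"
    "f False False False True False" "f False False False False True"
    "f False True True False False" "f False False False True True"
    "\<not> f False True False True False" "\<not> f False True False False True"
    "\<not> f False False True True False" "\<not> f False False True False True"
    "f False True True True True"
    using **[of True False False False] **[of False True False False]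
      **[of False False True False] **[of False False False True]
      **[of True True False False] **[of False False True True]
      **[of True False True False] **[of True False False True]
      **[of False True True False] **[of False True False True]
      **[of True True True True]
    by simp_all
qed

section \<open>Passage from the orbit to rotated coordinates\<close>

lemma elementary_ca_apply:
  "elementary_ca f x (i, j) = f (x (i, j)) (x (i, j + 1)) (x (i, j - 1)) (x (i - 1, j)) (x (i + 1, j))"
  by (simp add: elementary_ca_def)

text \<open>The neighbors of a site of wrong parity had wrong parity one step earlier, so all four
  are 0 and the output is 0 whatever the center.\<close>

lemma orbit_off_parity:
  assumes "T_a_rule f" "odd (i + j + int n)"
  shows "\<not> (elementary_ca f ^^ n) single_site_seed (i, j)"
  using assms(2)
proof (induction n arbitrary: i j)
  case 0
  then show ?case by (auto simp: single_site_seed_def)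
next
  case (Suc n)
  let ?x = "(elementary_ca f ^^ n) single_site_seed"
  have "\<not> ?x (i, j + 1)" "\<not> ?x (i, j - 1)" "\<not> ?x (i - 1, j)" "\<not> ?x (i + 1, j)"
    using Suc.prems by (intro Suc.IH; simp; presburger?)+
  then show ?case
    by (simp add: elementary_ca_apply T_a_rule_simps[OF assms(1)])
qed

lemma orbit_eq_rotated_orbit:
  assumes "T_a_rule f"
  shows "(elementary_ca f ^^ n) single_site_seed (a + b - int n, a - b) = rotated_orbit f n a b"
proof (induction n arbitrary: a b)
  case 0
  then show ?case by (auto simp: single_site_seed_def)
next
  case (Suc n)
  \<comment> \<open>This is the center read by the local rule; its vanishing justifies the
    \<open>False\<close> in \<open>evolve\<close>.\<close>
  have "\<not> (elementary_ca f ^^ n) single_site_seed (a + b - 1 - int n, a - b)"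
    by (rule orbit_off_parity[OF assms]) (simp; presburger)
  then show ?case
    using Suc.IH[of a "b - 1"] Suc.IH[of "a - 1" b] Suc.IH[of "a - 1" "b - 1"] Suc.IH[of a b]
    by (simp add: elementary_ca_apply evolve_def algebra_simps)
qed

text \<open>The coordinate map reaches only one parity class, but \<open>orbit_off_parity\<close>
  puts every 1 there, and on it the halvings of the inverse are exact.\<close>

lemma bij_betw_rotated_orbit:
  assumes "T_a_rule f"
  shows "bij_betw (\<lambda>(a, b). (a + b - int n, a - b)) {(a, b). rotated_orbit f n a b}
    {p. (elementary_ca f ^^ n) single_site_seed p}"
proof (rule bij_betwI[where g = "\<lambda>(i, j). ((i + j + int n) div 2, (i - j + int n) div 2)"])
  let ?x = "(elementary_ca f ^^ n) single_site_seed"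
  have decomp: "\<exists>a b. p = (a + b - int n, a - b)" if "?x p" for p
  proof -
    obtain i j where p: "p = (i, j)" by fastforce
    then have "even (i + j + int n)" using that orbit_off_parity[OF assms] by blast
    then obtain a where "i + j + int n = 2 * a" by (elim evenE)
    then show ?thesis unfolding p by (intro exI[of _ a] exI[of _ "a - j"]) simp
  qed
  show "(\<lambda>(a, b). (a + b - int n, a - b)) \<in> {(a, b). rotated_orbit f n a b} \<rightarrow> {p. ?x p}"
    using orbit_eq_rotated_orbit[OF assms] by auto
  show "(\<lambda>(i, j). ((i + j + int n) div 2, (i - j + int n) div 2))
      \<in> {p. ?x p} \<rightarrow> {(a, b). rotated_orbit f n a b}"
    using decomp orbit_eq_rotated_orbit[OF assms] by fastforce
  show "(case case p of (a, b) \<Rightarrow> (a + b - int n, a - b) of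
      (i, j) \<Rightarrow> ((i + j + int n) div 2, (i - j + int n) div 2)) = p" for p
    by (cases p) simp
  show "(case case p of (i, j) \<Rightarrow> ((i + j + int n) div 2, (i - j + int n) div 2) of
      (a, b) \<Rightarrow> (a + b - int n, a - b)) = p" if "p \<in> {p. ?x p}" for p
    using decomp[of p] that by auto
qed

lemma num_sites_eq_card:
  assumes "T_a_rule f"
  shows "num_sites (elementary_ca f) (Suc n) = card {(a, b). rotated_orbit f n a b}"
proof -
  let ?S = "{p. (elementary_ca f ^^ n) single_site_seed p}"
  have fin: "finite ?S" by (rule finite_support_orbit[OF assms])
  have "num_sites (elementary_ca f) (Suc n) = card ?S"
    unfolding num_sites_def using fin
    by (simp add: Sum_any.expand_set flip: of_bool_def)
  then show ?thesis
    using bij_betw_same_card[OF bij_betw_rotated_orbit[OF assms]] by simp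
qed

section \<open>Self-similar growth\<close>

lemma rotated_orbit_support:
  assumes "T_a_rule f" "rotated_orbit f n a b"
  shows "0 \<le> a \<and> a < int n + 1 \<and> 0 \<le> b \<and> b < int n + 1"
  using assms(2)
proof (induction n arbitrary: a b)
  case (Suc n)
  have "rotated_orbit f n a (b - 1) \<or> rotated_orbit f n (a - 1) b
      \<or> rotated_orbit f n (a - 1) (b - 1) \<or> rotated_orbit f n a b"
    using Suc.prems T_a_rule_simps(1)[OF assms(1), of False] unfolding rotated_orbit.simps evolve_def
    by metis
  then show ?case using Suc.IH by fastforce
qed simp

text \<open>Each corner of the enlarged box sees a single site of the old box, namely the old
  corner.\<close>

lemma rotated_orbit_corners:
  assumes "T_a_rule f" "a \<in> {0, int n}" "b \<in> {0, int n}"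
  shows "rotated_orbit f n a b"
  using assms(2,3)
proof (induction n arbitrary: a b)
  case (Suc n)
  have out: "\<not> rotated_orbit f n a b" if "a < 0 \<or> a > int n \<or> b < 0 \<or> b > int n" for a b
    using rotated_orbit_support[OF assms(1)] that by fastforce
  show ?case using Suc.prems Suc.IH
    by (auto simp: evolve_def out T_a_rule_simps[OF assms(1)])
qed simp

text \<open>A site on the edge of the central square sees two adjacent ones and gets 0, so the side
  shrinks by one. A unit square meets both the center and a copy only at the four corners; there two
  opposite ones give the same 1 as the lone corner seen by \<open>evolve f y\<close>.\<close>

lemma evolve_square_with_copies:
  assumes f: "T_a_rule f" and s: "0 < s" "s < K"
    and supp: "\<And>a b. y a b \<Longrightarrow> 0 \<le> a \<and> a < s \<and> 0 \<le> b \<and> b < s"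
    and corners: "y 0 0" "y 0 (s - 1)" "y (s - 1) 0" "y (s - 1) (s - 1)"
  shows "evolve f (square_with_copies K s y) = square_with_copies K (s + 1) (evolve f y)"
proof (intro ext)
  fix a b
  \<comment> \<open>Splitting each axis at \<open>s\<close> and \<open>K\<close> tells which of the coordinates seen by the local rule lie
    outside \<open>y\<close> and its translates; here \<open>P\<close> says that a row or column misses \<open>y\<close>.\<close>
  have regions: "x < s \<and> P (x - K) \<and> P (x - 1 - K) \<or>
      x = s \<and> P s \<and> P (s - K) \<and> P (s - 1 - K) \<or>
      s < x \<and> x < K \<and> P x \<and> P (x - 1) \<and> P (x - K) \<and> P (x - 1 - K) \<or>
      x = K \<and> P K \<and> P (K - 1) \<and> P (- 1) \<or> K < x \<and> P x \<and> P (x - 1)"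
    if "\<forall>x. x < 0 \<or> s \<le> x \<longrightarrow> P x" for x and P :: "int \<Rightarrow> bool"
    using s that by (cases "x < s"; cases "x = s"; cases "x < K"; cases "x = K") simp_all
  have rows: "\<forall>x. x < 0 \<or> s \<le> x \<longrightarrow> (\<forall>c. \<not> y x c)"
    and columns: "\<forall>x. x < 0 \<or> s \<le> x \<longrightarrow> (\<forall>c. \<not> y c x)"
    using supp by fastforce+
  from regions[of "\<lambda>x. \<forall>c. \<not> y x c" a, OF rows] regions[of "\<lambda>x. \<forall>c. \<not> y c x" b, OF columns]
  show "evolve f (square_with_copies K s y) a b = square_with_copies K (s + 1) (evolve f y) a b"
    using s by (elim disjE conjE)
      (simp_all add: evolve_def square_with_copies_def corners T_a_rule_simps[OF f] diff_right_commute)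
qed

text \<open>Interior sites see four ones, edge sites two adjacent ones, and the four outer corners
  exactly one, which plants four seeds.\<close>

lemma evolve_full_square:
  assumes f: "T_a_rule f" and "0 < K"
  shows "evolve f (\<lambda>a b. 0 \<le> a \<and> a < K \<and> 0 \<le> b \<and> b < K)
    = square_with_copies K 1 (\<lambda>a b. a = 0 \<and> b = 0)"
proof (intro ext)
  fix a b
  have "a < 0 \<or> a = 0 \<or> 0 < a \<and> a < K \<or> a = K \<or> K < a"
    "b < 0 \<or> b = 0 \<or> 0 < b \<and> b < K \<or> b = K \<or> K < b" by linarith+
  then show "evolve f (\<lambda>a b. 0 \<le> a \<and> a < K \<and> 0 \<le> b \<and> b < K) a b
    = square_with_copies K 1 (\<lambda>a b. a = 0 \<and> b = 0) a b"
    using assms(2) by (elim disjE conjE)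
      (simp_all add: evolve_def square_with_copies_def T_a_rule_simps[OF f])
qed

lemma rotated_orbit_doubling:
  assumes f: "T_a_rule f" and full: "rotated_orbit f (K - 1) = (\<lambda>a b. 0 \<le> a \<and> a < int K \<and> 0 \<le> b \<and> b < int K)"
    and "s < K"
  shows "rotated_orbit f (K + s) = square_with_copies (int K) (int s + 1) (rotated_orbit f s)"
  using \<open>s < K\<close>
proof (induction s)
  case 0
  \<comment> \<open>Since \<open>0 < K\<close>, time \<open>K\<close> is one step past the full
    square.\<close>
  then have "rotated_orbit f (K + 0) = evolve f (rotated_orbit f (K - 1))"
    by (cases K) simp_all
  then show ?case using 0 evolve_full_square[OF f, of "int K"] unfolding full by simp
next
  case (Suc s)
  have "evolve f (square_with_copies (int K) (int s + 1) (rotated_orbit f s))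
      = square_with_copies (int K) (int s + 1 + 1) (evolve f (rotated_orbit f s))"
  proof (rule evolve_square_with_copies[OF f])
    show "0 \<le> a \<and> a < int s + 1 \<and> 0 \<le> b \<and> b < int s + 1" if "rotated_orbit f s a b" for a b
      using rotated_orbit_support[OF f that] .
  qed (use Suc.prems in \<open>simp_all add: rotated_orbit_corners[OF f]\<close>)
  with Suc show ?case by (simp add: add.commute)
qed

text \<open>At the last step of the doubling the central square is empty and four full copies tile
  the square of twice the side.\<close>

lemma rotated_orbit_full:
  assumes f: "T_a_rule f"
  shows "rotated_orbit f (2 ^ k - 1) = (\<lambda>a b. 0 \<le> a \<and> a < int (2 ^ k) \<and> 0 \<le> b \<and> b < int (2 ^ k))"
proof (induction k)
  case 0
  show ?case by (intro ext) auto
next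
  case (Suc k)
  have "rotated_orbit f (2 ^ Suc k - 1) = rotated_orbit f (2 ^ k + (2 ^ k - 1))"
    by (simp add: mult_2)
  also have "\<dots> = square_with_copies (int (2 ^ k)) (int (2 ^ k - 1) + 1) (rotated_orbit f (2 ^ k - 1))"
    by (rule rotated_orbit_doubling[OF f Suc]) simp
  finally show ?case
    unfolding Suc by (intro ext) (auto simp: square_with_copies_def of_nat_diff)
qed

section \<open>Counting the ones\<close>

lemma card_square_with_copies:
  assumes s: "0 \<le> s" "s \<le> K"
    and supp: "\<And>a b. y a b \<Longrightarrow> 0 \<le> a \<and> a < s \<and> 0 \<le> b \<and> b < s"
  shows "card {(a, b). square_with_copies K s y a b} = nat (K - s) ^ 2 + 4 * card {(a, b). y a b}"
proof -
  let ?Y = "{(a, b). y a b}"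
  let ?Q = "{s..<K} \<times> {s..<K}"
  define C where "C u v = (\<lambda>(a, b). (a + u, b + v)) ` ?Y" for u v
  have "?Y \<subseteq> {0..<s} \<times> {0..<s}" using supp by auto
  then have "finite ?Y" by (rule finite_subset) simp
  then have fin: "finite (C u v)" for u v unfolding C_def by (rule finite_imageI)
  have mem: "(a, b) \<in> C u v \<longleftrightarrow> y (a - u) (b - v)" for a b u v
    unfolding C_def by force
  \<comment> \<open>Since \<open>s \<le> K\<close>, these boxes and the central square are pairwise
    disjoint, so the cardinalities add.\<close>
  have box: "u \<le> a \<and> a < u + s \<and> v \<le> b \<and> b < v + s" if "(a, b) \<in> C u v" for a b u v
    using supp[of "a - u" "b - v"] that by (simp add: mem)
  have card: "card (C u v) = card ?Y" for u v
    unfolding C_def by (rule card_image) (auto simp: inj_on_def)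
  have union: "{(a, b). square_with_copies K s y a b} = ?Q \<union> (C 0 0 \<union> (C K 0 \<union> (C 0 K \<union> C K K)))"
    by (simp add: set_eq_iff mem square_with_copies_def)
  have disj: "?Q \<inter> (C 0 0 \<union> (C K 0 \<union> (C 0 K \<union> C K K))) = {}"
    "C 0 0 \<inter> (C K 0 \<union> (C 0 K \<union> C K K)) = {}"
    "C K 0 \<inter> (C 0 K \<union> C K K) = {}" "C 0 K \<inter> C K K = {}"
    using s by (auto dest!: box)
  show ?thesis
    unfolding union
    by (simp add: card_Un_disjoint fin disj card card_cartesian_product power2_eq_square)
qed

lemma num_sites_power_add:
  assumes f: "T_a_rule f" and "s \<le> 2 ^ k"
  shows "num_sites (elementary_ca f) (2 ^ k + s)
    = (2 ^ k - s)\<^sup>2 + 4 * num_sites (elementary_ca f) s"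
proof (cases s)
  case 0
  \<comment> \<open>With \<open>num_sites\<close> equal to 0 at time 0 by convention, this case is
    just the count of the full square.\<close>
  have "num_sites (elementary_ca f) (2 ^ k) = num_sites (elementary_ca f) (Suc (2 ^ k - 1))"
    by simp
  also have "\<dots> = card ({0..<(2::int) ^ k} \<times> {0..<(2::int) ^ k})"
    unfolding num_sites_eq_card[OF f] rotated_orbit_full[OF f]
    by (rule arg_cong[where f = card]) auto
  finally show ?thesis using 0
    by (simp add: card_cartesian_product power2_eq_square num_sites_def nat_power_eq)
next
  case (Suc n)
  have "num_sites (elementary_ca f) (2 ^ k + s) = card {(a, b). rotated_orbit f (2 ^ k + n) a b}"
    using num_sites_eq_card[OF f, of "2 ^ k + n"] Suc by simp
  also have "rotated_orbit f (2 ^ k + n)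
      = square_with_copies (int (2 ^ k)) (int n + 1) (rotated_orbit f n)"
    using rotated_orbit_doubling[OF f rotated_orbit_full[OF f]] assms(2) Suc by simp
  also have "card {(a, b). square_with_copies (int (2 ^ k)) (int n + 1) (rotated_orbit f n) a b}
      = nat (int (2 ^ k) - (int n + 1)) ^ 2 + 4 * card {(a, b). rotated_orbit f n a b}"
  proof (rule card_square_with_copies)
    show "int n + 1 \<le> int (2 ^ k)" using assms(2) Suc by linarith
  qed (use rotated_orbit_support[OF f] in simp_all)
  also have "nat (int (2 ^ k) - (int n + 1)) = 2 ^ k - s"
    using Suc by linarith
  finally show ?thesis using Suc by (simp add: num_sites_eq_card[OF f])
qed

section \<open>The formula in binary digits\<close>

lemma binary_prefix_less:
  fixes b :: "nat \<Rightarrow> nat"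
  assumes "\<And>i. b i \<le> 1"
  shows "(\<Sum>i<k. b i * 2 ^ i) < 2 ^ k"
proof (induction k)
  case (Suc k)
  have "b k * 2 ^ k \<le> 1 * 2 ^ k" by (rule mult_right_mono[OF assms]) simp
  with Suc show ?case unfolding sum.lessThan_Suc power_Suc by linarith
qed simp

text \<open>Induction on the top bit: a new 1 multiplies the earlier terms by 4 and adds one square.
  When \<open>b p = 1\<close>, the squared quantity is \<open>2 ^ p\<close> minus the value of the
  bits below \<open>p\<close>.\<close>

lemma num_sites_binary:
  fixes b :: "nat \<Rightarrow> nat"
  assumes f: "T_a_rule f" and b: "\<And>i. b i \<in> {0, 1}"
  shows "int (num_sites (elementary_ca f) (\<Sum>i<k. b i * 2 ^ i)) =
    (\<Sum>p<k. int (b p) * 4 ^ (\<Sum>q=Suc p..<k. b q) * (2 ^ Suc p - (\<Sum>q\<le>p. int (b q) * 2 ^ q))\<^sup>2)"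
proof (induction k)
  case 0
  show ?case by (simp add: num_sites_def)
next
  case (Suc k)
  let ?t = "\<Sum>i<k. b i * 2 ^ i"
  let ?term = "\<lambda>k p. int (b p) * 4 ^ (\<Sum>q=Suc p..<k. b q) * (2 ^ Suc p - (\<Sum>q\<le>p. int (b q) * 2 ^ q))\<^sup>2"
  have b1: "b i \<le> 1" for i using b[of i] by auto
  have less: "?t < 2 ^ k" by (rule binary_prefix_less[OF b1])
  have shift: "(\<Sum>p<k. ?term (Suc k) p) = 4 ^ b k * (\<Sum>p<k. ?term k p)"
    unfolding sum_distrib_left by (intro sum.cong) (simp_all add: power_add mult_ac)
  show ?case
  proof (cases "b k = 0")
    case True
    then show ?thesis using Suc shift by simp
  next
    case False
    then have bk: "b k = 1" using b[of k] by auto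
    have "int (num_sites (elementary_ca f) (\<Sum>i<Suc k. b i * 2 ^ i))
        = int ((2 ^ k - ?t)\<^sup>2 + 4 * num_sites (elementary_ca f) ?t)"
      using num_sites_power_add[OF f, of ?t k] less bk by (simp add: add.commute)
    also have "\<dots> = (2 ^ k - int ?t)\<^sup>2 + 4 * (\<Sum>p<k. ?term k p)"
      using less Suc by (simp add: of_nat_diff)
    also have "\<dots> = (\<Sum>p<Suc k. ?term (Suc k) p)"
      using bk shift by (simp add: lessThan_Suc_atMost[symmetric] algebra_simps)
    finally show ?thesis .
  qed
qed

text \<open>The summand for \<open>j = 0\<close> reads position \<open>Suc k\<close>, where
  \<open>g\<close> vanishes, so only the positions from \<open>Suc p\<close> to \<open>k\<close>
  count.\<close>

lemma sum_shifted_top_bits: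
  fixes g :: "nat \<Rightarrow> 'a :: comm_monoid_add"
  assumes "p \<le> k" "g (Suc k) = 0"
  shows "(\<Sum>j=0..k - p. g (k - j + 1)) = (\<Sum>q=Suc p..<Suc k. g q)"
proof -
  have "(\<Sum>j=0..k - p. g (k - j + 1)) = (\<Sum>q=Suc p..Suc k. g q)"
    by (rule sum.reindex_bij_witness[where i = "\<lambda>q. Suc k - q" and j = "\<lambda>j. Suc k - j"])
      (use assms(1) in \<open>auto simp: Suc_diff_le\<close>)
  also have "\<dots> = (\<Sum>q=Suc p..<Suc k. g q)"
    using assms by (simp add: atLeastLessThanSuc_atLeastAtMost[symmetric] del: sum.op_ivl_Suc)
      (simp add: sum.op_ivl_Suc)
  finally show ?thesis .
qed

lemma num_sites_formula:
  fixes b :: "nat \<Rightarrow> nat"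
  assumes f: "T_a_rule f" and b: "\<And>i. b i \<in> {0, 1}" and bk: "b (Suc k) = 0"
    and t: "t = (\<Sum>i=0..k. b i * 2 ^ i)"
  shows "int (num_sites (elementary_ca f) t) =
    (\<Sum>i=0..k. int (b (k - i)) * 4 ^ (\<Sum>j=0..i. b (k - j + 1)) *
      (2 ^ (k - i + 1) - int t + (\<Sum>j=0..i. int (b (k - j + 1)) * 2 ^ (k - j + 1)))\<^sup>2)"
proof -
  have t': "t = (\<Sum>i<Suc k. b i * 2 ^ i)"
    unfolding t by (simp only: lessThan_Suc_atMost atMost_atLeast0)
  \<comment> \<open>Cutting \<open>t\<close> at bit \<open>p\<close> turns \<open>- t\<close> plus
    the high bits into minus the low bits, the form in \<open>num_sites_binary\<close>.\<close>
  have split: "int t = (\<Sum>q\<le>p. int (b q) * 2 ^ q) + (\<Sum>q=Suc p..<Suc k. int (b q) * 2 ^ q)"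
    if "p \<le> k" for p
  proof -
    have "int t = (\<Sum>q\<in>{0..<Suc k}. int (b q) * 2 ^ q)"
      unfolding t' by (simp add: lessThan_atLeast0)
    also have "\<dots> = (\<Sum>q\<in>{0..<Suc p}. int (b q) * 2 ^ q) + (\<Sum>q=Suc p..<Suc k. int (b q) * 2 ^ q)"
      using that by (intro sum.atLeastLessThan_concat[symmetric]) auto
    finally show ?thesis by (simp only: lessThan_atLeast0[symmetric] lessThan_Suc_atMost)
  qed
  have "int (num_sites (elementary_ca f) t) = (\<Sum>p\<in>{0..k}. int (b p) * 4 ^ (\<Sum>q=Suc p..<Suc k. b q) *
      (2 ^ Suc p - (\<Sum>q\<le>p. int (b q) * 2 ^ q))\<^sup>2)"
    unfolding t' num_sites_binary[OF f b] by (simp only: lessThan_Suc_atMost atMost_atLeast0)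
  also have "\<dots> = (\<Sum>i=0..k. int (b (k - i)) * 4 ^ (\<Sum>j=0..i. b (k - j + 1)) *
      (2 ^ (k - i + 1) - int t + (\<Sum>j=0..i. int (b (k - j + 1)) * 2 ^ (k - j + 1)))\<^sup>2)"
  proof (rule sum.reindex_bij_witness[where i = "\<lambda>i. k - i" and j = "\<lambda>i. k - i"])
    fix p assume p: "p \<in> {0..k}"
    then have le: "p \<le> k" by simp
    have "(\<Sum>j=0..k - p. int (b (k - j + 1)) * 2 ^ (k - j + 1)) = (\<Sum>q=Suc p..<Suc k. int (b q) * 2 ^ q)"
      using sum_shifted_top_bits[OF le, of "\<lambda>q. int (b q) * 2 ^ q"] bk by simp
    then show "int (b (k - (k - p))) * 4 ^ (\<Sum>j=0..k - p. b (k - j + 1)) *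
        (2 ^ (k - (k - p) + 1) - int t + (\<Sum>j=0..k - p. int (b (k - j + 1)) * 2 ^ (k - j + 1)))\<^sup>2
      = int (b p) * 4 ^ (\<Sum>q=Suc p..<Suc k. b q) * (2 ^ Suc p - (\<Sum>q\<le>p. int (b q) * 2 ^ q))\<^sup>2"
      unfolding sum_shifted_top_bits[OF le, of b, OF bk] using le split[OF le] by simp
  qed auto
  finally show ?thesis .
qed

section \<open>Cumulative counts at powers of two\<close>

lemma sum_squares_below:
  "6 * (\<Sum>s=1..K. (real (K - s))\<^sup>2) = real K * (real K - 1) * (2 * real K - 1)"
proof -
  have "(\<Sum>s=1..K. (real (K - s))\<^sup>2) = (\<Sum>m<K. (real m)\<^sup>2)"
    by (rule sum.reindex_bij_witness[where i = "\<lambda>m. K - m" and j = "\<lambda>s. K - s"]) auto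
  moreover have "6 * (\<Sum>m<K. (real m)\<^sup>2) = real K * (real K - 1) * (2 * real K - 1)"
    by (induction K) (simp_all add: algebra_simps power2_eq_square)
  ultimately show ?thesis by simp
qed

text \<open>The second half of the range repeats the first half four times and adds a sum of
  squares, hence a factor 5; the 6 clears the denominator of that sum.\<close>

lemma cum_sites_double:
  assumes f: "T_a_rule f"
  shows "6 * real (cum_sites (elementary_ca f) (2 ^ Suc k))
    = 30 * real (cum_sites (elementary_ca f) (2 ^ k)) + 2 ^ k * (2 ^ k - 1) * (2 * 2 ^ k - 1)"
proof -
  let ?N = "num_sites (elementary_ca f)"
  let ?K = "2 ^ k :: nat"
  have "cum_sites (elementary_ca f) (2 ^ Suc k) = (\<Sum>n=1..?K. ?N n) + (\<Sum>n=?K+1..?K+?K. ?N n)"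
    unfolding cum_sites_def power_Suc mult_2 by (rule sum.ub_add_nat) simp
  also have "(\<Sum>n=?K+1..?K+?K. ?N n) = (\<Sum>s=1..?K. ?N (?K + s))"
    using sum.shift_bounds_cl_nat_ivl[of ?N 1 ?K ?K] by (simp add: add.commute)
  also have "\<dots> = (\<Sum>s=1..?K. (?K - s)\<^sup>2 + 4 * ?N s)"
    by (intro sum.cong num_sites_power_add[OF f]) auto
  finally have "real (cum_sites (elementary_ca f) (2 ^ Suc k))
      = 5 * real (cum_sites (elementary_ca f) ?K) + (\<Sum>s=1..?K. (real (?K - s))\<^sup>2)"
    unfolding cum_sites_def by (simp add: sum.distrib flip: sum_distrib_left)
  then show ?thesis using sum_squares_below[of ?K] by simp
qed

text \<open>The term in \<open>5 ^ k\<close> is the homogeneous solution of the recurrence; the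
  others come from its cubic polynomial in \<open>2 ^ k\<close>.\<close>

lemma cum_sites_formula:
  assumes f: "T_a_rule f"
  shows "real (cum_sites (elementary_ca f) (2 ^ k)) = 1 / 18 * (2 * 8 ^ k + 8 * 5 ^ k + 9 * 4 ^ k - 2 ^ k)"
proof (induction k)
  case 0
  have "num_sites (elementary_ca f) 1 = 1"
    using num_sites_power_add[OF f, of 0 0] by (simp add: num_sites_def)
  then show ?case by (simp add: cum_sites_def)
next
  case (Suc k)
  have "(4::real) ^ k = 2 ^ k * 2 ^ k" "(8::real) ^ k = 2 ^ k * 2 ^ k * 2 ^ k"
    by (simp_all flip: power_mult_distrib)
  then show ?case using cum_sites_double[OF f, of k] Suc by (simp add: algebra_simps)
qed

theorem proposition3:
  fixes f :: local_rule
  assumes "T_a_rule f"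
  shows "(\<forall>(k::nat) (b::nat \<Rightarrow> nat) (t::nat).
           (\<forall>i. b i \<in> {0, 1}) \<and> (\<forall>i>k. b i = 0) \<and> t = (\<Sum>i=0..k. b i * 2 ^ i) \<longrightarrow>
           int (num_sites (elementary_ca f) t) =
             (\<Sum>i=0..k. int (b (k - i)) * 4 ^ (\<Sum>j=0..i. b (k - j + 1)) *
                (2 ^ (k - i + 1) - int t + (\<Sum>j=0..i. int (b (k - j + 1)) * 2 ^ (k - j + 1)))\<^sup>2))
       \<and> (\<forall>k::nat. real (cum_sites (elementary_ca f) (2 ^ k)) =
             1 / 18 * (2 * 8 ^ k + 8 * 5 ^ k + 9 * 4 ^ k - 2 ^ k))"
proof (intro conjI allI impI)
  fix k t :: nat and b :: "nat \<Rightarrow> nat"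
  assume "(\<forall>i. b i \<in> {0, 1}) \<and> (\<forall>i>k. b i = 0) \<and> t = (\<Sum>i=0..k. b i * 2 ^ i)"
  then show "int (num_sites (elementary_ca f) t) =
      (\<Sum>i=0..k. int (b (k - i)) * 4 ^ (\<Sum>j=0..i. b (k - j + 1)) *
        (2 ^ (k - i + 1) - int t + (\<Sum>j=0..i. int (b (k - j + 1)) * 2 ^ (k - j + 1)))\<^sup>2)"
    by (intro num_sites_formula[OF assms]) auto
next
  fix k :: nat
  show "real (cum_sites (elementary_ca f) (2 ^ k)) =
      1 / 18 * (2 * 8 ^ k + 8 * 5 ^ k + 9 * 4 ^ k - 2 ^ k)"
    by (rule cum_sites_formula[OF assms])
qed

end
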